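(* Let $U\subseteq\mathbb{R}^N$ be open and let $\mathcal{F}$ be a real vector space (under pointwise operations) of $C^1$ functions $F:U\to\mathbb{R}^M$. Suppose that $\mathcal{F}$ has a rank-maximizer. Then $\mathcal{F}$ has almost constant rank (ACR); that is, for almost every $F\in\mathcal{F}$, one has $\operatorname{rank}(DF(x))=\operatorname{maxrank}(\mathcal{F})$ for Lebesgue almost every $x\in U$.
   Context: $DF(x)$ is the $M\times N$ Jacobian matrix of $F$ at $x$. A $C^1$ function $F:U\to\mathbb{R}^M$ has almost constant rank (is ACR) if there is an integer $\rho\ge 0$ such that $\operatorname{rank}(DF(x))=\rho$ for Lebesgue almost every $x\in U$. Put $\operatorname{maxrank}(F)=\max_{x\in U}\operatorname{rank}(DF(x))$ and $\operatorname{maxrank}(\mathcal{F})=\max_{F\in\mathcal{F},\,x\in U}\operatorname{rank}(DF(x))$. A rank-maximizer for $\mathcal{F}$ is an ACR function $F\in\mathcal{F}$ with $\operatorname{maxrank}(F)=\operatorname{maxrank}(\mathcal{F})$. The vector space $\mathcal{F}$ has almost constant rank (is ACR) if for almost every $F\in\mathcal{F}$ and almost every $x\in U$, $\operatorname{rank}(DF(x))=\operatorname{maxrank}(\mathcal{F})$. "Almost every $F\in\mathcal{F}$": if $\mathcal{F}$ is finite-dimensional, this is with respect to Lebesgue measure on $\mathcal{F}$. If $\mathcal{F}$ is infinite-dimensional, it is in the sense of prevalence: a set $G\subseteq\mathcal{F}$ is called measurable if $Z\cap G$ is Lebesgue measurable in $Z$ for every finite-dimensional plane (affine subspace) $Z\subseteq\mathcal{F}$;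 almost every element of $\mathcal{F}$ is in a measurable set $G$ if there is a finite-dimensional linear subspace $X\subseteq\mathcal{F}$ such that for every $P\in\mathcal{F}$ and Lebesgue almost every $H\in X$ one has $H+P\in G$. A property holds for almost every $F\in\mathcal{F}$ if it holds for all $F$ in some such measurable $G$. *)

theory Defs
  imports "HOL-Analysis.Analysis" "HOL-Library.Function_Algebras"
begin

instantiation "fun" :: (type, real_vector) real_vector
begin

definition scaleR_fun :: "real \<Rightarrow> ('a \<Rightarrow> 'b) \<Rightarrow> 'a \<Rightarrow> 'b"
  where "scaleR_fun r f = (\<lambda>x. r *\<^sub>R f x)"

instance
  by standard (simp_all add: scaleR_fun_def fun_eq_iff algebra_simps)

end

(* A function U \<rightarrow> R^M is represented by its extension by 0 outside U.  Pointwise operations on U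
   then correspond exactly to the pointwise operations of the type, so that "subspace \<F>" with
   "\<F> \<subseteq> C1_functions U" says that \<F> is a real vector space of C^1 functions on U. *)
definition C1_functions :: "(real^'n) set \<Rightarrow> (real^'n \<Rightarrow> real^'m) set"
  where "C1_functions U = {F. (\<forall>x. x \<notin> U \<longrightarrow> F x = 0)
    \<and> (\<forall>x\<in>U. F differentiable (at x)) \<and> continuous_on U (\<lambda>x. jacobian F (at x))}"

definition ACR_fun :: "(real^'n) set \<Rightarrow> (real^'n \<Rightarrow> real^'m) \<Rightarrow> bool"
  where "ACR_fun U F \<longleftrightarrow> (\<exists>\<rho>. AE x in lebesgue_on U. rank (jacobian F (at x)) = \<rho>)"

definition maxrank_fun :: "(real^'n) set \<Rightarrow> (real^'n \<Rightarrow> real^'m) \<Rightarrow> nat"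
  where "maxrank_fun U F = Max {rank (jacobian F (at x)) | x. x \<in> U}"

definition maxrank_space :: "(real^'n) set \<Rightarrow> (real^'n \<Rightarrow> real^'m) set \<Rightarrow> nat"
  where "maxrank_space U \<F> = Max {rank (jacobian F (at x)) | F x. F \<in> \<F> \<and> x \<in> U}"

definition rank_maximizer ::
    "(real^'n) set \<Rightarrow> (real^'n \<Rightarrow> real^'m) set \<Rightarrow> (real^'n \<Rightarrow> real^'m) \<Rightarrow> bool"
  where "rank_maximizer U \<F> F \<longleftrightarrow>
    F \<in> \<F> \<and> ACR_fun U F \<and> maxrank_fun U F = maxrank_space U \<F>"

(* For B finite and independent: Lebesgue measure of R^B transported to the plane P + span B by
   the affine coordinates of B.  The normalisation depends on B and the choice of origin P is
   immaterial; only measurable sets and null sets, which depend on the plane alone, are used. *)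
definition plane_lebesgue :: "'v::real_vector \<Rightarrow> 'v set \<Rightarrow> 'v measure"
  where "plane_lebesgue P B =
    embed_measure (completion (PiM B (\<lambda>_. lborel :: real measure))) (\<lambda>c. P + (\<Sum>b\<in>B. c b *\<^sub>R b))"

definition finite_basis :: "'v::real_vector set \<Rightarrow> 'v set \<Rightarrow> bool"
  where "finite_basis X B \<longleftrightarrow> finite B \<and> independent B \<and> span B = X"

definition finite_dimensional :: "'v::real_vector set \<Rightarrow> bool"
  where "finite_dimensional X \<longleftrightarrow> (\<exists>B. finite_basis X B)"

(* Only meaningful for a finite-dimensional linear subspace X; vacuous otherwise. *)
definition almost_every_findim :: "'v::real_vector set \<Rightarrow> ('v \<Rightarrow> bool) \<Rightarrow> bool"
  where "almost_every_findim X Q \<longleftrightarrow>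
    (\<forall>B. finite_basis X B \<longrightarrow> (AE H in plane_lebesgue 0 B. Q H))"

definition plane_measurable :: "'v::real_vector set \<Rightarrow> 'v set \<Rightarrow> bool"
  where "plane_measurable V G \<longleftrightarrow> G \<subseteq> V \<and>
    (\<forall>P\<in>V. \<forall>B\<subseteq>V. finite B \<and> independent B \<longrightarrow>
       ((\<lambda>H. P + H) ` span B) \<inter> G \<in> sets (plane_lebesgue P B))"

definition prevalent :: "'v::real_vector set \<Rightarrow> 'v set \<Rightarrow> bool"
  where "prevalent V G \<longleftrightarrow> plane_measurable V G \<and>
    (\<exists>X. subspace X \<and> X \<subseteq> V \<and> finite_dimensional X \<and>
       (\<forall>P\<in>V. almost_every_findim X (\<lambda>H. H + P \<in> G)))"

definition almost_every :: "'v::real_vector set \<Rightarrow> ('v \<Rightarrow> bool) \<Rightarrow> bool"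
  where "almost_every V Q \<longleftrightarrow>
    (if finite_dimensional V then almost_every_findim V Q
     else \<exists>G. prevalent V G \<and> (\<forall>F\<in>G. Q F))"

definition ACR_space :: "(real^'n) set \<Rightarrow> (real^'n \<Rightarrow> real^'m) set \<Rightarrow> bool"
  where "ACR_space U \<F> \<longleftrightarrow> almost_every \<F>
    (\<lambda>F. AE x in lebesgue_on U. rank (jacobian F (at x)) = maxrank_space U \<F>)"

end

theory Submission
  imports Defs
begin

text \<open>If \<open>rank B \<ge> r\<close>, then \<open>rank (A + t *\<^sub>R B) < r\<close> for only finitely many \<open>t\<close>. Let \<open>F\<close> be a
  rank-maximizer and \<open>r\<close> the maximal rank. Since \<open>{M. r \<le> rank M}\<close> is open and \<open>DF\<close> is continuous,
  the almost constant rank of \<open>F\<close> is \<open>r\<close>. Hence for almost every \<open>x\<close> and every \<open>P\<close>,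
  \<open>rank (DP(x) + t DF(x)) = r\<close> for all but finitely many \<open>t\<close>, and by Fubini, for almost every \<open>t\<close>,
  \<open>P + t F\<close> has rank \<open>r\<close> almost everywhere. So the line spanned by \<open>F\<close> is a probe for prevalence;
  on a finite-dimensional plane whose direction contains \<open>F\<close>, one applies Fubini once more along
  the lines in direction \<open>F\<close>.\<close>

section \<open>Rank inequalities, determinants and matrix pencils\<close>

lemma rank_add_le:
  fixes A B :: "real^'n^'m"
  shows "rank (A + B) \<le> rank A + rank B"
proof -
  let ?S = "range ((*v) A)" and ?T = "range ((*v) B)"
  have "rank (A + B) \<le> dim {x + y |x y. x \<in> ?S \<and> y \<in> ?T}"
    unfolding rank_dim_range
    by (intro dim_subset) (auto simp: matrix_vector_mult_add_rdistrib)
  also have "\<dots> \<le> dim ?S + dim ?T"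
    using dim_sums_Int[of ?S ?T]
    by (simp add: linear_subspace_image)
  finally show ?thesis
    by (simp add: rank_dim_range)
qed

lemma rank_scaleR_le:
  fixes A :: "real^'n^'m"
  shows "rank (t *\<^sub>R A) \<le> rank A"
proof -
  have "t *\<^sub>R A = A ** (t *\<^sub>R mat 1)"
    by (simp add: matrix_scalar_ac flip: scalar_matrix_assoc)
  then show ?thesis
    by (metis rank_mul_le_left)
qed

text \<open>The kernel meets the row space only in \<open>0\<close>, and row rank equals rank. This
  half of rank-nullity bounds the rank of a projection onto the kernel.\<close>

lemma dim_kernel_le:
  fixes A :: "real^'n^'m"
  shows "dim {x. A *v x = 0} + rank A \<le> CARD('n)"
proof -
  let ?K = "{x. A *v x = 0}" and ?R = "span (rows A)"
  have "subspace ?K"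
    by (simp add: subspace_def matrix_vector_right_distrib matrix_vector_mult_scaleR)
  moreover have "?K \<inter> ?R = {0}"
    using nullspace_inter_rowspace[of A] by auto
  ultimately have "dim ?K + dim ?R = dim {x + y |x y. x \<in> ?K \<and> y \<in> ?R}"
    using dim_sums_Int[of ?K ?R] by simp
  also have "\<dots> \<le> CARD('n)"
    by (rule dim_subset_UNIV_cart)
  finally show ?thesis
    by (simp add: row_rank_def)
qed

text \<open>A substitute for minors: rank conditions become the nonvanishing of a full-size determinant.
  With \<open>L\<close> the transpose of \<open>A\<close> and \<open>Q\<close> a projection onto the kernel of \<open>A\<close>,
  the matrix \<open>L ** A + Q\<close> is injective.\<close>

lemma rank_ge_iff_det:
  fixes A :: "real^'n^'m"
  shows "r \<le> rank A \<longleftrightarrow>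
    (\<exists>(L::real^'m^'n) (Q::real^'n^'n). rank Q + r \<le> CARD('n) \<and> det (L ** A + Q) \<noteq> 0)"
proof
  assume r: "r \<le> rank A"
  let ?K = "{x. A *v x = 0}"
  have K: "subspace ?K"
    by (simp add: subspace_def matrix_vector_right_distrib matrix_vector_mult_scaleR)
  obtain g :: "real^'n \<Rightarrow> real^'n"
    where g: "range g \<subseteq> ?K" "linear g" "\<forall>x\<in>?K. g x = x"
    using linear_exists_left_inverse_on[OF linear_id K] by auto
  define Q where "Q = matrix g"
  have Qg: "Q *v x = g x" for x
    unfolding Q_def using g(2) by (metis matrix_works linear_matrix_vector_mul_eq)
  have "rank Q \<le> dim ?K"
    unfolding rank_dim_range using g(1) by (intro dim_subset) (auto simp: Qg)
  with r dim_kernel_le[of A] have "rank Q + r \<le> CARD('n)"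
    by linarith
  moreover have "x = 0" if x: "(transpose A ** A + Q) *v x = 0" for x
  proof -
    have AQ: "A *v g x = 0" for x
      using g(1) by auto
    have eq: "transpose A *v (A *v x) + g x = 0"
      using x by (simp add: matrix_vector_mult_add_rdistrib matrix_vector_mul_assoc Qg)
    \<comment> \<open>Pairing with \<open>g x\<close> kills the first summand because
      \<open>A *v g x = 0\<close>; pairing what remains with \<open>x\<close> then gives the squared
      norm of \<open>A *v x\<close>.\<close>
    have "0 = (transpose A *v (A *v x) + g x) \<bullet> g x"
      using eq by simp
    also have "\<dots> = g x \<bullet> g x"
      using AQ[of x] by (simp add: inner_add_left dot_lmul_matrix vector_transpose_matrix
          flip: matrix_vector_mul_assoc)
    finally have gx: "g x = 0"
      by simp
    then have "(transpose A *v (A *v x)) \<bullet> x = 0"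
      using eq by simp
    then have "A *v x = 0"
      by (simp add: dot_lmul_matrix vector_transpose_matrix)
    with g(3) gx show "x = 0"
      by auto
  qed
  then have "det (transpose A ** A + Q) \<noteq> 0"
    by (metis invertible_det_nz invertible_left_inverse matrix_left_invertible_ker)
  ultimately show "\<exists>(L::real^'m^'n) (Q::real^'n^'n). rank Q + r \<le> CARD('n) \<and> det (L ** A + Q) \<noteq> 0"
    by blast
next
  assume "\<exists>(L::real^'m^'n) (Q::real^'n^'n). rank Q + r \<le> CARD('n) \<and> det (L ** A + Q) \<noteq> 0"
  then obtain L :: "real^'m^'n" and Q :: "real^'n^'n"
    where Q: "rank Q + r \<le> CARD('n)" and d: "det (L ** A + Q) \<noteq> 0"
    by blast
  have "CARD('n) = rank (L ** A + Q)"
    using d rank_bound[of "L ** A + Q"] by (simp add: det_eq_0_rank)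
  also have "\<dots> \<le> rank A + rank Q"
    using rank_add_le[of "L ** A" Q] rank_mul_le_right[of L A] by linarith
  finally show "r \<le> rank A"
    using Q by linarith
qed

lemma continuous_on_matrix_mult_right:
  fixes L :: "real^'m^'k"
  shows "continuous_on S (\<lambda>A::real^'n^'m. L ** A)"
  unfolding matrix_matrix_mult_def by (intro continuous_intros)

lemma continuous_on_det:
  fixes f :: "'a::topological_space \<Rightarrow> real^'n^'n"
  assumes "continuous_on S f"
  shows "continuous_on S (\<lambda>x. det (f x))"
  unfolding det_def by (intro continuous_intros assms)

text \<open>The determinant criterion writes the set as a union, over \<open>L\<close> and
  \<open>Q\<close>, of preimages of the nonzero reals under continuous maps.\<close>

lemma open_rank_ge: "open {A :: real^'n^'m. r \<le> rank A}"
proof -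
  have "{A :: real^'n^'m. r \<le> rank A} =
    (\<Union>L. \<Union>Q\<in>{Q. rank Q + r \<le> CARD('n)}. {A. det (L ** A + Q) \<noteq> 0})"
    by (subst rank_ge_iff_det) auto
  also have "open \<dots>"
    by (intro open_UN ballI open_Collect_neq continuous_on_det continuous_on_add
        continuous_on_matrix_mult_right continuous_on_const)
  finally show ?thesis .
qed

lemma finite_det_pencil_eq_0:
  fixes C D :: "real^'n^'n"
  assumes "det C \<noteq> 0"
  shows "finite {t. det (D + t *\<^sub>R C) = 0}"
proof -
  \<comment> \<open>in the variable \<open>s = 1 / t\<close>, the constant coefficient is \<open>det C\<close>\<close>
  define q where "q = det (\<chi> i j. [:C $ i $ j, D $ i $ j:])"
  have q: "poly q s = det (C + s *\<^sub>R D)" for s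
    unfolding q_def det_def by (simp add: poly_sum poly_prod)
  have "poly q 0 \<noteq> 0"
    using assms by (simp add: q)
  then have "q \<noteq> 0"
    by auto
  then have "finite {s. poly q s = 0}"
    by (rule poly_roots_finite)
  \<comment> \<open>\<open>0\<close> is inserted because \<open>t = 0\<close> corresponds to no
    value of \<open>s = 1 / t\<close>.\<close>
  then have "finite (insert 0 (inverse ` {s. poly q s = 0}))"
    by simp
  moreover have "t \<in> insert 0 (inverse ` {s. poly q s = 0})" if "det (D + t *\<^sub>R C) = 0" for t
  proof (cases "t = 0")
    case False
    have "C + inverse t *\<^sub>R D = inverse t *\<^sub>R (D + t *\<^sub>R C)"
      using False by (simp add: algebra_simps)
    also have "\<dots> = (inverse t *\<^sub>R mat 1) ** (D + t *\<^sub>R C)"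
      by (simp flip: scalar_matrix_assoc)
    finally have "poly q (inverse t) = 0"
      using that by (simp add: q det_mul)
    then show ?thesis
      by (auto intro!: image_eqI[of t inverse "inverse t"])
  qed auto
  ultimately show ?thesis
    by (elim rev_finite_subset) blast
qed

text \<open>Witnesses \<open>L\<close>, \<open>Q\<close> for \<open>B\<close> serve for all
  \<open>t\<close>: \<open>L ** A + t *\<^sub>R (L ** B + Q)\<close> is
  \<open>L ** (A + t *\<^sub>R B) + t *\<^sub>R Q\<close>, and scaling does not raise the rank of
  \<open>Q\<close>. So each bad \<open>t\<close> is a root of a determinant pencil.\<close>

lemma finite_rank_pencil_less:
  fixes A B :: "real^'n^'m"
  assumes "r \<le> rank B"
  shows "finite {t. rank (A + t *\<^sub>R B) < r}"
proof -
  obtain L :: "real^'m^'n" and Q :: "real^'n^'n"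
    where Q: "rank Q + r \<le> CARD('n)" and d: "det (L ** B + Q) \<noteq> 0"
    using assms rank_ge_iff_det by blast
  have "det (L ** A + t *\<^sub>R (L ** B + Q)) = 0" if "rank (A + t *\<^sub>R B) < r" for t
  proof (rule ccontr)
    assume "det (L ** A + t *\<^sub>R (L ** B + Q)) \<noteq> 0"
    moreover have "L ** A + t *\<^sub>R (L ** B + Q) = L ** (A + t *\<^sub>R B) + t *\<^sub>R Q"
      by (simp add: matrix_add_ldistrib matrix_scalar_ac scalar_matrix_assoc algebra_simps)
    moreover have "rank (t *\<^sub>R Q) + r \<le> CARD('n)"
      using Q rank_scaleR_le[of t Q] by linarith
    ultimately have "r \<le> rank (A + t *\<^sub>R B)"
      using rank_ge_iff_det by metis
    with that show False
      by simp
  qed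
  then show ?thesis
    using finite_det_pencil_eq_0[OF d, of "L ** A"] by (auto elim!: finite_subset[rotated])
qed

section \<open>Translation invariance and Fubini in coordinate space\<close>

text \<open>A product measure is determined by its values on boxes, and there the claim reduces to
  translation invariance in each coordinate.\<close>

lemma distr_PiM_lborel_translate:
  fixes v :: "'i \<Rightarrow> real"
  assumes "finite I"
  shows "distr (PiM I (\<lambda>_. lborel)) (PiM I (\<lambda>_. lborel)) (\<lambda>c. \<lambda>i\<in>I. c i + v i) =
    PiM I (\<lambda>_. lborel)"
proof -
  interpret product_sigma_finite "\<lambda>_::'i. lborel :: real measure" ..
  let ?P = "PiM I (\<lambda>_. lborel :: real measure)"
  let ?T = "\<lambda>c. \<lambda>i\<in>I. c i + v i"
  have T: "?T \<in> measurable ?P ?P"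
    by measurable
  show ?thesis
  proof (rule PiM_eqI[OF assms])
    fix A :: "'i \<Rightarrow> real set"
    assume A: "\<And>i. i \<in> I \<Longrightarrow> A i \<in> sets lborel"
    have vA: "(\<lambda>t. t + v i) -` A i \<in> sets lborel" if "i \<in> I" for i
      using measurable_sets[of "\<lambda>t. t + v i" lborel lborel "A i"] A[OF that] by simp
    have "?T -` Pi\<^sub>E I A \<inter> space ?P = (\<Pi>\<^sub>E i\<in>I. (\<lambda>t. t + v i) -` A i)"
      by (auto simp: space_PiM PiE_iff)
    then have "emeasure (distr ?P ?P ?T) (Pi\<^sub>E I A) = emeasure ?P (\<Pi>\<^sub>E i\<in>I. (\<lambda>t. t + v i) -` A i)"
      using A assms by (simp add: emeasure_distr[OF T])
    also have "\<dots> = (\<Prod>i\<in>I. emeasure lborel ((\<lambda>t. t + v i) -` A i))"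
      using vA assms by (intro emeasure_PiM) auto
    also have "\<dots> = (\<Prod>i\<in>I. emeasure lborel (A i))"
    proof (rule prod.cong[OF refl])
      fix i assume "i \<in> I"
      then have "emeasure (distr lborel borel ((+) (v i))) (A i) =
          emeasure lborel ((\<lambda>t. t + v i) -` A i)"
        using A by (subst emeasure_distr) (auto simp: add.commute[of _ "v i"])
      then show "emeasure lborel ((\<lambda>t. t + v i) -` A i) = emeasure lborel (A i)"
        by (simp add: lborel_distr_plus)
    qed
    finally show "emeasure (distr ?P ?P ?T) (Pi\<^sub>E I A) = (\<Prod>i\<in>I. emeasure lborel (A i))" .
  qed simp
qed

text \<open>Every line in direction \<open>v\<close> meets the exceptional set in a null set, so by Fubini some,
  hence by translation invariance every, translate of the exceptional set is null.\<close>

lemma AE_PiM_lborel_if_AE_lines: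
  fixes v :: "'i \<Rightarrow> real"
  assumes I: "finite I"
    and P[measurable]: "Measurable.pred (PiM I (\<lambda>_. lborel)) P"
    and lines: "\<And>c. AE t in lborel. P (\<lambda>i\<in>I. c i + t * v i)"
  shows "AE c in PiM I (\<lambda>_. lborel). P c"
proof -
  let ?M = "PiM I (\<lambda>_. lborel :: real measure)"
  interpret product_sigma_finite "\<lambda>_::'i. lborel :: real measure" ..
  interpret sigma_finite_measure ?M
    using I by (rule sigma_finite)
  interpret pair_sigma_finite ?M "lborel :: real measure" ..
  have "AE c in ?M. AE t in lborel. P (\<lambda>i\<in>I. c i + t * v i)"
    using lines by simp
  then have "AE t in lborel. AE c in ?M. P (\<lambda>i\<in>I. c i + t * v i)"
    by (subst (asm) AE_commute) measurable
  \<comment> \<open>\<open>lborel\<close> is not the zero measure, so a property of almost every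
    \<open>t\<close> holds for some \<open>t\<close>.\<close>
  then have "\<exists>t. AE c in ?M. P (\<lambda>i\<in>I. c i + t * v i)"
    using eventually_happens[where net = "ae_filter lborel"] by (auto simp: ae_filter_eq_bot_iff)
  then obtain t where "AE c in ?M. P (\<lambda>i\<in>I. c i + t * v i)" ..
  then have "AE c in distr ?M ?M (\<lambda>c. \<lambda>i\<in>I. c i + t * v i). P c"
    by (subst AE_distr_iff) measurable
  then show ?thesis
    by (simp only: distr_PiM_lborel_translate[OF I])
qed

lemma pred_rank_ge:
  fixes f :: "'a \<Rightarrow> real^'n^'m"
  assumes "f \<in> borel_measurable M"
  shows "Measurable.pred M (\<lambda>x. r \<le> rank (f x))"
proof (rule measurable_compose[OF assms])
  show "Measurable.pred borel (\<lambda>A :: real^'n^'m. r \<le> rank A)"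
    by (simp add: pred_def open_rank_ge borel_open)
qed

text \<open>Along each line in direction \<open>v\<close> the matrix is a pencil whose
  \<open>t\<close>-coefficient has rank at least \<open>r\<close>, so only finitely many points of
  the line are bad.\<close>

lemma AE_PiM_rank_ge:
  fixes A :: "real^'n^'m" and J :: "'i \<Rightarrow> real^'n^'m"
  assumes I: "finite I" and r: "r \<le> rank (\<Sum>i\<in>I. v i *\<^sub>R J i)"
  shows "AE c in PiM I (\<lambda>_. lborel). r \<le> rank (A + (\<Sum>i\<in>I. c i *\<^sub>R J i))"
proof (rule AE_PiM_lborel_if_AE_lines[OF I])
  have "(\<lambda>c. A + (\<Sum>i\<in>I. c i *\<^sub>R J i)) \<in> borel_measurable (PiM I (\<lambda>_. lborel))"
    by measurable
  then show "Measurable.pred (PiM I (\<lambda>_. lborel)) (\<lambda>c. r \<le> rank (A + (\<Sum>i\<in>I. c i *\<^sub>R J i)))"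
    by (rule pred_rank_ge)
next
  fix c :: "'i \<Rightarrow> real"
  let ?A = "A + (\<Sum>i\<in>I. c i *\<^sub>R J i)" and ?B = "\<Sum>i\<in>I. v i *\<^sub>R J i"
  have "A + (\<Sum>i\<in>I. (\<lambda>i\<in>I. c i + t * v i) i *\<^sub>R J i) = ?A + t *\<^sub>R ?B" for t
    by (simp add: scaleR_add_left sum.distrib scaleR_sum_right cong: sum.cong)
  moreover have "AE t in lborel. t \<notin> {t. rank (?A + t *\<^sub>R ?B) < r}"
    using finite_rank_pencil_less[OF r, of ?A]
    by (intro AE_not_in finite_imp_null_set_lborel)
  ultimately show "AE t in lborel. r \<le> rank (A + (\<Sum>i\<in>I. (\<lambda>i\<in>I. c i + t * v i) i *\<^sub>R J i))"
    by (simp add: not_less add.assoc)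
qed

text \<open>The measure of the bad section over \<open>y\<close> depends measurably on
  \<open>y\<close>; the set in question is where it vanishes.\<close>

lemma (in sigma_finite_measure) sets_AE_pair:
  assumes "Measurable.pred (N \<Otimes>\<^sub>M M) (\<lambda>z. P (fst z) (snd z))"
  shows "{y \<in> space N. AE x in M. P y x} \<in> sets N"
proof -
  let ?Q = "{z \<in> space (N \<Otimes>\<^sub>M M). \<not> P (fst z) (snd z)}"
  have Q: "?Q \<in> sets (N \<Otimes>\<^sub>M M)"
    using assms by measurable
  have "(AE x in M. P y x) \<longleftrightarrow> emeasure M (Pair y -` ?Q) = 0" if "y \<in> space N" for y
  proof (rule AE_iff_measurable)
    show "Pair y -` ?Q \<in> sets M"
      using Q by (rule sets_Pair1)
    show "{x \<in> space M. \<not> P y x} = Pair y -` ?Q"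
      using that by (auto simp: space_pair_measure)
  qed
  then have "{y \<in> space N. AE x in M. P y x} = {y \<in> space N. emeasure M (Pair y -` ?Q) = 0}"
    by blast
  also have "\<dots> \<in> sets N"
    using measurable_emeasure_Pair[OF Q] by measurable
  finally show ?thesis .
qed

section \<open>Jacobians and the almost constant rank of a maximizer\<close>

lemma sum_fun_apply: "(\<Sum>i\<in>I. f i) x = (\<Sum>i\<in>I. f i x)"
  by (induction I rule: infinite_finite_induct) auto

lemma jacobian_eqI:
  fixes A :: "real^'n^'m"
  assumes "(F has_derivative (*v) A) (at x)"
  shows "jacobian F (at x) = A"
  using assms by (simp add: jacobian_def matrix_of_matrix_vector_mul flip: frechet_derivative_at)

lemma jacobian_add_sum_scaleR:
  fixes P :: "real^'n \<Rightarrow> real^'m"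
  assumes "P differentiable (at x)" and "\<And>b. b \<in> B \<Longrightarrow> b differentiable (at x)"
  shows "jacobian (P + (\<Sum>b\<in>B. c b *\<^sub>R b)) (at x) =
    jacobian P (at x) + (\<Sum>b\<in>B. c b *\<^sub>R jacobian b (at x))"
proof (rule jacobian_eqI)
  have "((\<lambda>y. P y + (\<Sum>b\<in>B. c b *\<^sub>R b y)) has_derivative
      (\<lambda>h. jacobian P (at x) *v h + (\<Sum>b\<in>B. c b *\<^sub>R (jacobian b (at x) *v h)))) (at x)"
    using assms by (intro has_derivative_add has_derivative_sum has_derivative_scaleR_right)
      (auto simp flip: jacobian_works)
  moreover have "(\<Sum>b\<in>B. c b *\<^sub>R (A b *v h)) = (\<Sum>b\<in>B. c b *\<^sub>R A b) *v h"
    for A :: "_ \<Rightarrow> real^'n^'m" and h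
    by (induction B rule: infinite_finite_induct)
      (auto simp: matrix_vector_mult_add_rdistrib scaleR_matrix_vector_assoc)
  then have "(*v) (jacobian P (at x) + (\<Sum>b\<in>B. c b *\<^sub>R jacobian b (at x))) =
      (\<lambda>h. jacobian P (at x) *v h + (\<Sum>b\<in>B. c b *\<^sub>R (jacobian b (at x) *v h)))"
    by (simp add: fun_eq_iff matrix_vector_mult_add_rdistrib)
  ultimately show "(P + (\<Sum>b\<in>B. c b *\<^sub>R b) has_derivative
      (*v) (jacobian P (at x) + (\<Sum>b\<in>B. c b *\<^sub>R jacobian b (at x)))) (at x)"
    by (simp add: plus_fun_def sum_fun_apply scaleR_fun_def)
qed

lemma C1_functionsD:
  assumes "F \<in> C1_functions U"
  shows "x \<in> U \<Longrightarrow> F differentiable (at x)" and "continuous_on U (\<lambda>x. jacobian F (at x))"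
  using assms by (auto simp: C1_functions_def)

lemma finite_ranks: "finite {rank (f z :: real^'n^'m) |z. P z}"
  by (rule finite_subset[of _ "{..CARD('n)}"]) (use rank_bound in \<open>auto simp: min.bounded_iff\<close>)

lemma rank_jacobian_le_maxrank_space:
  fixes F :: "real^'n \<Rightarrow> real^'m"
  assumes "F \<in> \<F>" "x \<in> U"
  shows "rank (jacobian F (at x)) \<le> maxrank_space U \<F>"
  unfolding maxrank_space_def
proof (rule Max_ge)
  show "finite {rank (jacobian F (at x)) |F x. F \<in> \<F> \<and> x \<in> U}"
    using finite_ranks[of "\<lambda>z. jacobian (fst z) (at (snd z))" "\<lambda>z. fst z \<in> \<F> \<and> snd z \<in> U"]
    by simp
qed (use assms in blast)

text \<open>Passing to the Borel measure \<open>lborel\<close> on the whole space makes Fubini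
  directly applicable.\<close>

lemma AE_lebesgue_on_iff:
  assumes "U \<in> sets borel"
  shows "(AE x in lebesgue_on U. P x) \<longleftrightarrow> (AE x in lborel. x \<in> U \<longrightarrow> P x)"
  using assms by (simp add: AE_restrict_space_iff AE_completion_iff)

text \<open>The points of maximal rank form a nonempty open set, hence not a null set, so the almost
  sure rank \<open>\<rho>\<close> is taken somewhere on it.\<close>

lemma rank_maximizer_AE_rank_eq:
  fixes F :: "real^'n \<Rightarrow> real^'m"
  assumes U: "open U" and F: "F \<in> C1_functions U" and max: "rank_maximizer U \<F> F"
  shows "AE x in lebesgue_on U. rank (jacobian F (at x)) = maxrank_space U \<F>"
\<comment> \<open>For empty \<open>U\<close> the \<open>Max\<close> is unspecified, but the claim is
  vacuous.\<close>
proof (cases "U = {}")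
  case True
  then show ?thesis
    by (simp add: AE_lebesgue_on_iff)
next
  case False
  let ?r = "maxrank_space U \<F>"
  obtain \<rho> where \<rho>: "AE x in lebesgue_on U. rank (jacobian F (at x)) = \<rho>"
    using max by (auto simp: rank_maximizer_def ACR_fun_def)
  let ?V = "{x \<in> U. ?r \<le> rank (jacobian F (at x))}"
  have "?r = Max {rank (jacobian F (at x)) |x. x \<in> U}"
    using max by (simp add: rank_maximizer_def maxrank_fun_def)
  also have "\<dots> \<in> {rank (jacobian F (at x)) |x. x \<in> U}"
    using False finite_ranks[of "\<lambda>x. jacobian F (at x)" "\<lambda>x. x \<in> U"] by (intro Max_in) auto
  finally have "?V \<noteq> {}"
    by auto
  moreover have "open ?V"
    using continuous_open_preimage[OF C1_functionsD(2)[OF F] U open_rank_ge[of ?r]]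
    by (simp add: vimage_def Int_def)
  ultimately have "?V \<notin> null_sets lborel"
    using open_not_negligible[of ?V] null_sets_completionI[of ?V lborel]
    by (auto simp: negligible_iff_null_sets)
  moreover have "?V \<in> null_sets lborel" if "\<And>x. x \<in> ?V \<Longrightarrow> rank (jacobian F (at x)) \<noteq> \<rho>"
  proof -
    have "AE x in lborel. x \<notin> ?V"
      using \<rho> that U by (subst (asm) AE_lebesgue_on_iff) (auto elim!: eventually_mono)
    with \<open>open ?V\<close> show ?thesis
      by (subst AE_iff_null_sets) auto
  qed
  ultimately obtain x where x: "x \<in> ?V" "rank (jacobian F (at x)) = \<rho>"
    by blast
  with max rank_jacobian_le_maxrank_space[of F \<F> x U] have "\<rho> = ?r"
    by (auto simp: rank_maximizer_def)
  with \<rho> show ?thesis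
    by simp
qed

section \<open>Affine coordinates on finite-dimensional planes\<close>

text \<open>Points of the product space are extensional, so agreement on \<open>B\<close> is
  equality. Injectivity is what makes \<open>embed_measure\<close> a faithful transport.\<close>

lemma inj_on_affine_coordinates:
  assumes "independent B" "finite B"
  shows "inj_on (\<lambda>c. P + (\<Sum>b\<in>B. c b *\<^sub>R b)) (space (PiM B (\<lambda>_. lborel)))"
proof (rule inj_onI)
  fix c d :: "'a \<Rightarrow> real"
  assume c: "c \<in> space (PiM B (\<lambda>_. lborel))" and d: "d \<in> space (PiM B (\<lambda>_. lborel))"
    and "P + (\<Sum>b\<in>B. c b *\<^sub>R b) = P + (\<Sum>b\<in>B. d b *\<^sub>R b)"
  then have "(\<Sum>b\<in>B. (c b - d b) *\<^sub>R b) = 0"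
    by (simp add: scaleR_diff_left sum_subtractf)
  then have "c b = d b" if "b \<in> B" for b
    using independentD[OF assms(1,2) order_refl, of "\<lambda>b. c b - d b"] that by auto
  with c d show "c = d"
    by (auto simp: space_PiM intro: PiE_ext)
qed

text \<open>Completion does not change which properties hold almost everywhere, so the product of
  \<open>lborel\<close> suffices.\<close>

lemma AE_plane_lebesgue_iff:
  assumes "independent B" "finite B"
  shows "(AE H in plane_lebesgue P B. Q H) \<longleftrightarrow>
    (AE c in PiM B (\<lambda>_. lborel). Q (P + (\<Sum>b\<in>B. c b *\<^sub>R b)))"
  unfolding plane_lebesgue_def
  by (simp add: AE_embed_measure' inj_on_affine_coordinates[OF assms] AE_completion_iff)

lemma image_in_sets_plane_lebesgue:
  assumes "independent B" "finite B" "C \<in> sets (PiM B (\<lambda>_. lborel))"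
  shows "(\<lambda>c. P + (\<Sum>b\<in>B. c b *\<^sub>R b)) ` C \<in> sets (plane_lebesgue P B)"
  unfolding plane_lebesgue_def using assms
  by (intro in_sets_embed_measure) (auto intro: sets_completionI_sets)

lemma span_eq_image_coordinates:
  assumes "finite B"
  shows "span B = (\<lambda>c. \<Sum>b\<in>B. c b *\<^sub>R b) ` space (PiM B (\<lambda>_. lborel))"
proof -
  \<comment> \<open>Restricting \<open>c\<close> to \<open>B\<close> makes it extensional without
    changing the sum.\<close>
  have "(\<Sum>b\<in>B. c b *\<^sub>R b) \<in> (\<lambda>c. \<Sum>b\<in>B. c b *\<^sub>R b) ` space (PiM B (\<lambda>_. lborel))" for c
    by (rule image_eqI[where x = "restrict c B"]) (auto simp: space_PiM)
  then show ?thesis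
    by (auto simp: span_finite[OF assms])
qed

section \<open>The rank condition on a plane through \<open>P\<close>\<close>

context
  fixes U :: "(real^'n) set" and B :: "(real^'n \<Rightarrow> real^'m) set" and P :: "real^'n \<Rightarrow> real^'m"
  assumes U: "open U" and B: "finite B" "B \<subseteq> C1_functions U" and P: "P \<in> C1_functions U"
begin

text \<open>Joint measurability in coefficients and point serves both Fubini and the measurability
  of the good set.\<close>

lemma pred_rank_jacobian_plane:
  "Measurable.pred (PiM B (\<lambda>_. lborel) \<Otimes>\<^sub>M lborel)
    (\<lambda>z. snd z \<in> U \<longrightarrow> r \<le> rank (jacobian (P + (\<Sum>b\<in>B. fst z b *\<^sub>R b)) (at (snd z))))"
proof -
  let ?M = "PiM B (\<lambda>_. lborel) \<Otimes>\<^sub>M (lborel :: (real^'n) measure)"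
  \<comment> \<open>Continuity of the Jacobian is known only on \<open>U\<close>; cutting it off to
    \<open>0\<close> elsewhere gives a Borel function.\<close>
  define g where "g F x = indicator U x *\<^sub>R jacobian F (at x)"
    for F :: "real^'n \<Rightarrow> real^'m" and x
  have "g F \<in> borel_measurable borel" if "F \<in> C1_functions U" for F
    unfolding g_def using U C1_functionsD(2)[OF that]
    by (intro borel_measurable_continuous_on_indicator) auto
  then have [measurable]: "g F \<in> borel_measurable lborel" if "F \<in> C1_functions U" for F
    using that by simp
  have [measurable]: "U \<in> sets borel"
    using U by simp
  have "(\<lambda>z. g P (snd z) + (\<Sum>b\<in>B. fst z b *\<^sub>R g b (snd z))) \<in> borel_measurable ?M"
  proof (intro borel_measurable_add borel_measurable_sum borel_measurable_scaleR)
    show "(\<lambda>z. g P (snd z)) \<in> borel_measurable ?M"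
      using P by measurable
    show "(\<lambda>z. g b (snd z)) \<in> borel_measurable ?M" if "b \<in> B" for b
      using B(2) that by (intro measurable_compose[OF measurable_snd]) auto
    show "(\<lambda>z. fst z b) \<in> borel_measurable ?M" if "b \<in> B" for b
      using measurable_compose[OF measurable_fst measurable_component_singleton[OF that, of "\<lambda>_. lborel"]]
      by simp
  qed
  then have [measurable]: "Measurable.pred ?M
      (\<lambda>z. r \<le> rank (g P (snd z) + (\<Sum>b\<in>B. fst z b *\<^sub>R g b (snd z))))"
    by (rule pred_rank_ge)
  have "Measurable.pred ?M
      (\<lambda>z. snd z \<in> U \<longrightarrow> r \<le> rank (g P (snd z) + (\<Sum>b\<in>B. fst z b *\<^sub>R g b (snd z))))"
    by measurable
  moreover have "jacobian (P + (\<Sum>b\<in>B. c b *\<^sub>R b)) (at x) = g P x + (\<Sum>b\<in>B. c b *\<^sub>R g b x)"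
    if "x \<in> U" for c x
    using that B(2) P by (subst jacobian_add_sum_scaleR) (auto simp: g_def intro: C1_functionsD(1))
  ultimately show ?thesis
    by (simp cong: imp_cong)
qed

lemma sets_AE_rank_jacobian_ge:
  "{c \<in> space (PiM B (\<lambda>_. lborel)).
    AE x in lborel. x \<in> U \<longrightarrow> r \<le> rank (jacobian (P + (\<Sum>b\<in>B. c b *\<^sub>R b)) (at x))}
    \<in> sets (PiM B (\<lambda>_. lborel))"
  using pred_rank_jacobian_plane by (rule lborel.sets_AE_pair)

text \<open>At fixed \<open>x\<close> the Jacobian is affine in the coefficients, and those of
  \<open>F\<close> give the direction of the pencils. Fubini then exchanges the two
  quantifiers.\<close>

lemma AE_AE_rank_jacobian_ge:
  assumes F: "F \<in> span B"
    and r: "AE x in lborel. x \<in> U \<longrightarrow> r \<le> rank (jacobian F (at x))"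
  shows "AE c in PiM B (\<lambda>_. lborel).
    AE x in lborel. x \<in> U \<longrightarrow> r \<le> rank (jacobian (P + (\<Sum>b\<in>B. c b *\<^sub>R b)) (at x))"
proof -
  interpret product_sigma_finite "\<lambda>_::real^'n \<Rightarrow> real^'m. lborel :: real measure" ..
  interpret sigma_finite_measure "PiM B (\<lambda>_. lborel :: real measure)"
    using B(1) by (rule sigma_finite)
  interpret pair_sigma_finite "PiM B (\<lambda>_. lborel :: real measure)" "lborel :: (real^'n) measure" ..
  obtain v where v: "F = (\<Sum>b\<in>B. v b *\<^sub>R b)"
    using F by (auto simp: span_finite[OF B(1)])
  have diff: "b differentiable (at x)" if "b \<in> B" "x \<in> U" for b x
    using that B(2) C1_functionsD(1) by blast
  have "AE x in lborel. AE c in PiM B (\<lambda>_. lborel). x \<in> U \<longrightarrow>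
      r \<le> rank (jacobian (P + (\<Sum>b\<in>B. c b *\<^sub>R b)) (at x))"
    using r
  proof eventually_elim
    case (elim x)
    show ?case
    proof (cases "x \<in> U")
      case True
      \<comment> \<open>With base point \<open>0\<close>, the formula for Jacobians on a plane
        applies to \<open>F\<close> itself.\<close>
      have "(*v) (0 :: real^'n^'m) = (\<lambda>h. 0)"
        by (simp add: fun_eq_iff)
      then have "jacobian 0 (at x) = (0 :: real^'n^'m)"
        by (intro jacobian_eqI) (simp add: zero_fun_def)
      moreover have "(0 :: real^'n \<Rightarrow> real^'m) differentiable (at x)"
        by (simp add: zero_fun_def)
      ultimately have "jacobian F (at x) = (\<Sum>b\<in>B. v b *\<^sub>R jacobian b (at x))"
        using jacobian_add_sum_scaleR[of 0 x B v] diff True by (simp add: v)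
      with elim True have "AE c in PiM B (\<lambda>_. lborel).
          r \<le> rank (jacobian P (at x) + (\<Sum>b\<in>B. c b *\<^sub>R jacobian b (at x)))"
        by (intro AE_PiM_rank_ge[OF B(1)]) auto
      then show ?thesis
        using True diff C1_functionsD(1)[OF P True] by (simp add: jacobian_add_sum_scaleR)
    qed simp
  qed
  then show ?thesis
    using pred_rank_jacobian_plane by (subst AE_commute) (auto simp: pred_def)
qed

end

theorem theorem1:
  fixes U :: "(real^'n) set"
    and \<F> :: "(real^'n \<Rightarrow> real^'m) set"
  assumes "open U"
    and "subspace \<F>"
    and "\<F> \<subseteq> C1_functions U"
    and "\<exists>F. rank_maximizer U \<F> F"
  shows "ACR_space U \<F>"
proof -
  let ?r = "maxrank_space U \<F>"
  let ?Q = "\<lambda>H. AE x in lebesgue_on U. rank (jacobian H (at x)) = ?r"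
  obtain F where F: "F \<in> \<F>" "rank_maximizer U \<F> F"
    using assms(4) by (auto simp: rank_maximizer_def)
  \<comment> \<open>Since \<open>?r\<close> bounds all ranks on \<open>U\<close>, equality reduces
    to a lower bound, an open condition on the Jacobian.\<close>
  have Q_iff: "?Q H \<longleftrightarrow> (AE x in lborel. x \<in> U \<longrightarrow> ?r \<le> rank (jacobian H (at x)))" if "H \<in> \<F>" for H
    using assms(1) rank_jacobian_le_maxrank_space[OF that]
    by (subst AE_lebesgue_on_iff) (auto intro!: AE_cong intro: antisym)
  have "?Q F"
    using rank_maximizer_AE_rank_eq[OF assms(1) _ F(2)] F(1) assms(3) by blast
  with F(1) have rF: "AE x in lborel. x \<in> U \<longrightarrow> ?r \<le> rank (jacobian F (at x))"
    by (simp add: Q_iff)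
  have plane: "P + (\<Sum>b\<in>B. c b *\<^sub>R b) \<in> \<F>" if "P \<in> \<F>" "B \<subseteq> \<F>" for P B c
    using assms(2) that by (intro subspace_add subspace_sum subspace_scale) auto
  \<comment> \<open>Both cases rest on this: \<open>P = 0\<close> with a basis of the whole space,
    or any \<open>P\<close> with a basis of the line through \<open>F\<close>.\<close>
  have AE_Q: "AE H in plane_lebesgue P B. ?Q H"
    if "P \<in> \<F>" "B \<subseteq> \<F>" "finite B" "independent B" "F \<in> span B" for P B
    using AE_AE_rank_jacobian_ge[OF assms(1) that(3) _ _ that(5) rF, of P]
      subset_trans[OF that(2) assms(3)] subsetD[OF assms(3) that(1)] that
    by (simp add: AE_plane_lebesgue_iff Q_iff plane)
  show ?thesis
    unfolding ACR_space_def
  proof (cases "finite_dimensional \<F>")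
    case True
    have "AE H in plane_lebesgue 0 B. ?Q H" if "finite_basis \<F> B" for B
      using that AE_Q[of 0 B] F(1) assms(2) span_superset[of B]
      by (auto simp: finite_basis_def subspace_0)
    with True show "almost_every \<F> ?Q"
      by (simp add: almost_every_def almost_every_findim_def)
  next
    case False
    let ?G = "{H \<in> \<F>. ?Q H}"
    have "plane_measurable \<F> ?G"
      unfolding plane_measurable_def
    proof (intro conjI ballI allI impI)
      fix P B assume P: "P \<in> \<F>" and B: "B \<subseteq> \<F>" "finite B \<and> independent B"
      let ?C = "{c \<in> space (PiM B (\<lambda>_. lborel)).
        AE x in lborel. x \<in> U \<longrightarrow> ?r \<le> rank (jacobian (P + (\<Sum>b\<in>B. c b *\<^sub>R b)) (at x))}"
      \<comment> \<open>In coordinates the good part of the plane is a measurable set, even when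
        \<open>F\<close> is not in \<open>span B\<close>.\<close>
      have "((\<lambda>H. P + H) ` span B) \<inter> ?G = (\<lambda>c. P + (\<Sum>b\<in>B. c b *\<^sub>R b)) ` ?C"
        using B P by (auto simp: span_eq_image_coordinates Q_iff plane)
      moreover have "?C \<in> sets (PiM B (\<lambda>_. lborel))"
        using assms(1,3) B P by (intro sets_AE_rank_jacobian_ge) auto
      ultimately show "((\<lambda>H. P + H) ` span B) \<inter> ?G \<in> sets (plane_lebesgue P B)"
        using B by (simp add: image_in_sets_plane_lebesgue)
    qed auto
    moreover have "subspace (span {F})" "span {F} \<subseteq> \<F>"
      using F(1) assms(2) by (auto simp: span_minimal)
    \<comment> \<open>\<open>F = 0\<close> can occur when the maximal rank is \<open>0\<close>; the
      basis is then empty.\<close>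
    moreover have "finite_dimensional (span {F})"
      unfolding finite_dimensional_def finite_basis_def
      using independent_empty dependent_single[of F]
      by (cases "F = 0") (auto intro: exI[of _ "{}"] exI[of _ "{F}"])
    moreover have "almost_every_findim (span {F}) (\<lambda>H. H + P \<in> ?G)" if P: "P \<in> \<F>" for P
      unfolding almost_every_findim_def finite_basis_def
    proof (intro allI impI)
      fix B assume B: "finite B \<and> independent B \<and> span B = span {F}"
      have BF: "B \<subseteq> \<F>"
        using B \<open>span {F} \<subseteq> \<F>\<close> span_superset[of B] by auto
      have "F \<in> span B"
        using B span_base[of F "{F}"] by simp
      \<comment> \<open>Adding \<open>P\<close> to the plane through \<open>0\<close> gives the
        plane through \<open>P\<close> with the same coordinates.\<close>
      with AE_Q[OF P BF] B show "AE H in plane_lebesgue 0 B. H + P \<in> ?G"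
        using P BF by (simp add: AE_plane_lebesgue_iff plane add.commute[of _ P])
    qed
    ultimately have "prevalent \<F> ?G"
      unfolding prevalent_def by blast
    with False show "almost_every \<F> ?Q"
      by (auto simp: almost_every_def)
  qed
qed

end
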